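(* There exists a sampling problem, defined for infinitely many network sizes $n$ (a network on $n$ nodes together with a target probability distribution over the joint outputs of the nodes, with no inputs), that can be solved exactly with $2$ rounds in the quantum LOCAL model, but requires $\Omega(n)$ rounds in the classical LOCAL model, where $n$ denotes the number of nodes. The classical lower bound holds even for constant-error additive approximation: there is a constant $c>0$ such that any classical LOCAL algorithm whose output distribution is within total variation distance $c$ of the target distribution requires $\Omega(n)$ rounds.
   Context: LOCAL model: the network is an undirected unweighted graph; each node is a processor with a distinct identifier, initially knowing only its incident edges and the total number $n$ of nodes. Computation proceeds in synchronous rounds; in each round every node may perform arbitrary local computation and send one message of unbounded size to each neighbour. In the classical LOCAL model processors are probabilistic (private randomness) and messages are classical; in the quantum LOCAL model processors are quantum and messages are quantum states. Initially the nodes share neither randomness nor entanglement. At the end each node outputs a value; the joint output is a random variable whose distribution is the distribution generated by the algorithm. The total variation distance between distributions $p,q$ on a finite set $X$ is $\frac12\sum_{x\in X}|p(x)-q(x)|$. *)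

theory Defs
  imports "HOL-Probability.Probability"
begin

text \<open>A network on n nodes: nodes are 0,...,n-1 (the node index serves as its
distinct identifier); E is a symmetric irreflexive adjacency relation on them.\<close>

definition graph_on :: "nat \<Rightarrow> (nat \<Rightarrow> nat \<Rightarrow> bool) \<Rightarrow> bool" where
  "graph_on n E \<longleftrightarrow> (\<forall>u v. E u v \<longrightarrow> u < n \<and> v < n \<and> u \<noteq> v \<and> E v u)"

fun near :: "(nat \<Rightarrow> nat \<Rightarrow> bool) \<Rightarrow> nat \<Rightarrow> nat \<Rightarrow> nat \<Rightarrow> bool" where
  "near E 0 v u = (u = v)"
| "near E (Suc k) v u = (near E k v u \<or> (\<exists>w. near E k v w \<and> E w u))"

definition tv_dist :: "('a \<Rightarrow> real) \<Rightarrow> ('a \<Rightarrow> real) \<Rightarrow> real" where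
  "tv_dist p q = (1/2) * infsum (\<lambda>x. \<bar>p x - q x\<bar>) UNIV"

text \<open>Each node v has private randomness \<omega> v, independent and uniform on [0,1]
(which can generate any private random source). A T-round classical LOCAL algorithm
on a fixed network: node v's output is an arbitrary function of the private
randomness of the nodes within distance T of v (this is exactly what v can learn in
T rounds with unbounded messages).\<close>

definition rand_space :: "nat \<Rightarrow> (nat \<Rightarrow> real) measure" where
  "rand_space n = PiM {0..<n} (\<lambda>_. uniform_measure lborel {0..1::real})"

definition classical_alg ::
  "nat \<Rightarrow> (nat \<Rightarrow> nat \<Rightarrow> bool) \<Rightarrow> nat \<Rightarrow> (nat \<Rightarrow> (nat \<Rightarrow> real) \<Rightarrow> nat) \<Rightarrow> bool" where
  "classical_alg n E T f \<longleftrightarrow>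
     (\<forall>v<n. \<forall>\<omega> \<omega>'. (\<forall>u. near E T v u \<longrightarrow> \<omega> u = \<omega>' u) \<longrightarrow> f v \<omega> = f v \<omega>')
   \<and> (\<lambda>\<omega>. map (\<lambda>v. f v \<omega>) [0..<n]) \<in> measurable (rand_space n) (count_space UNIV)"

definition classical_prob ::
  "nat \<Rightarrow> (nat \<Rightarrow> (nat \<Rightarrow> real) \<Rightarrow> nat) \<Rightarrow> nat list \<Rightarrow> real" where
  "classical_prob n f x =
     measure (rand_space n) {\<omega> \<in> space (rand_space n). map (\<lambda>v. f v \<omega>) [0..<n] = x}"

text \<open>Labels of computational basis states of a node's (unbounded, finite-dimensional
at any time) local register. A label Node k m denotes a register kept locally
(content k) together with an outgoing message register m u for each neighbour u.\<close>

datatype lab = Leaf nat | Node lab "nat \<Rightarrow> lab"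

fun key :: "lab \<Rightarrow> lab" where
  "key (Node k m) = k"
| "key (Leaf i) = Leaf i"

fun msgs :: "lab \<Rightarrow> nat \<Rightarrow> lab" where
  "msgs (Node k m) = m"
| "msgs (Leaf i) = (\<lambda>_. Leaf 0)"

text \<open>A local operation: a matrix U b a = <b|U|a> whose columns are finitely supported
and orthonormal, i.e. an isometry. (By Stinespring/Naimark dilation and deferred
measurement, local isometries plus a final computational-basis measurement capture
arbitrary local quantum channels, private randomness and POVMs.)\<close>

definition isometry :: "(lab \<Rightarrow> lab \<Rightarrow> complex) \<Rightarrow> bool" where
  "isometry U \<longleftrightarrow> (\<forall>a. finite {b. U b a \<noteq> 0}) \<and>
     (\<forall>a a'. (\<Sum>b\<in>{b. U b a \<noteq> 0}. cnj (U b a) * U b a') = (if a = a' then 1 else 0))"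

definition well_formed :: "(nat \<Rightarrow> nat \<Rightarrow> bool) \<Rightarrow> nat \<Rightarrow> (lab \<Rightarrow> lab \<Rightarrow> complex) \<Rightarrow> bool" where
  "well_formed E v U \<longleftrightarrow>
     (\<forall>a b. U b a \<noteq> 0 \<longrightarrow> (\<exists>k m. b = Node k m \<and> (\<forall>u. \<not> E v u \<longrightarrow> m u = Leaf 0)))"

type_synonym qstate = "(nat \<Rightarrow> lab) \<Rightarrow> complex"

definition apply_local :: "nat \<Rightarrow> (nat \<Rightarrow> lab \<Rightarrow> lab \<Rightarrow> complex) \<Rightarrow> qstate \<Rightarrow> qstate" where
  "apply_local n U \<psi> = (\<lambda>b. if (\<forall>v\<ge>n. b v = Leaf 0)
      then (\<Sum>a\<in>{a. \<psi> a \<noteq> 0}. \<psi> a * (\<Prod>v<n. U v (b v) (a v))) else 0)"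

definition exch :: "nat \<Rightarrow> (nat \<Rightarrow> nat \<Rightarrow> bool) \<Rightarrow> (nat \<Rightarrow> lab) \<Rightarrow> (nat \<Rightarrow> lab)" where
  "exch n E b = (\<lambda>u. if u < n
      then Node (key (b u)) (\<lambda>v. if E v u then msgs (b v) u else Leaf 0) else Leaf 0)"

definition push :: "((nat \<Rightarrow> lab) \<Rightarrow> (nat \<Rightarrow> lab)) \<Rightarrow> qstate \<Rightarrow> qstate" where
  "push g \<psi> = (\<lambda>c. \<Sum>b\<in>{b. \<psi> b \<noteq> 0 \<and> g b = c}. \<psi> b)"

text \<open>Global state after t rounds; initially every node is in the fixed state |Leaf 0>
(no shared randomness or entanglement).\<close>

primrec qrun :: "nat \<Rightarrow> (nat \<Rightarrow> nat \<Rightarrow> bool) \<Rightarrow> (nat \<Rightarrow> nat \<Rightarrow> lab \<Rightarrow> lab \<Rightarrow> complex) \<Rightarrow> nat \<Rightarrow> qstate" where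
  "qrun n E U 0 = (\<lambda>a. if a = (\<lambda>_. Leaf 0) then 1 else 0)"
| "qrun n E U (Suc t) = push (exch n E) (apply_local n (U t) (qrun n E U t))"

definition quantum_alg ::
  "nat \<Rightarrow> (nat \<Rightarrow> nat \<Rightarrow> bool) \<Rightarrow> nat \<Rightarrow> (nat \<Rightarrow> nat \<Rightarrow> lab \<Rightarrow> lab \<Rightarrow> complex)
   \<Rightarrow> (nat \<Rightarrow> lab \<Rightarrow> lab \<Rightarrow> complex) \<Rightarrow> bool" where
  "quantum_alg n E T U W \<longleftrightarrow>
     (\<forall>t<T. \<forall>v<n. isometry (U t v) \<and> well_formed E v (U t v)) \<and> (\<forall>v<n. isometry (W v))"

definition quantum_prob ::
  "nat \<Rightarrow> (nat \<Rightarrow> nat \<Rightarrow> bool) \<Rightarrow> nat \<Rightarrow> (nat \<Rightarrow> nat \<Rightarrow> lab \<Rightarrow> lab \<Rightarrow> complex)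
   \<Rightarrow> (nat \<Rightarrow> lab \<Rightarrow> lab \<Rightarrow> complex) \<Rightarrow> (nat \<Rightarrow> lab \<Rightarrow> nat) \<Rightarrow> nat list \<Rightarrow> real" where
  "quantum_prob n E T U W out x =
     (let \<psi> = apply_local n W (qrun n E U T) in
      \<Sum>a\<in>{a. \<psi> a \<noteq> 0 \<and> map (\<lambda>v. out v (a v)) [0..<n] = x}. (cmod (\<psi> a))\<^sup>2)"

end

theory Submission
  imports Defs
begin

text \<open>
  The network is a spider with three arms of length L and n = 3 L + 1. The centre prepares a GHZ state,
  and every edge carries a Bell pair; Bell measurements along the arms teleport the three GHZ qubits to
  the tips up to Pauli errors, and each tip flips a coin to choose between an X and a Y measurement. The
  errors on an arm are a function of the outputs on this arm. The corrected outcomes therefore satisfy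
  the GHZ parity constraint whenever an even number of tips chose Y.

  Classically, take two independent samples of all the randomness, such that all tips choose X in the
  first one and Y in the second one. Replacing the outer part of some of the arms of the first sample by
  the second sample leaves the law of the outputs unchanged, and if 2 T < L, every arm only notices
  whether it has been resampled itself. The four choices of an even number of resampled arms cannot all
  satisfy the parity constraint, so the constraint is violated with constant probability.
\<close>

text \<open>Node v has parent v - 3; by truncation the nodes 1, 2, 3 are the children of the centre 0,
  and the three arms of the spider are the residue classes modulo 3.\<close>

definition spider :: "nat \<Rightarrow> nat \<Rightarrow> nat \<Rightarrow> bool" where
  "spider n u v \<longleftrightarrow> u < n \<and> v < n \<and> u \<noteq> v \<and> (u = v - 3 \<or> v = u - 3)"

definition tip :: "nat \<Rightarrow> nat \<Rightarrow> bool" where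
  "tip n v \<longleftrightarrow> v < n \<and> n \<le> v + 3"

lemma graph_on_spider: "graph_on n (spider n)"
  by (auto simp: graph_on_def spider_def)

section \<open>The quantum algorithm\<close>

definition uniform_state :: "(nat \<Rightarrow> lab) set \<Rightarrow> complex \<Rightarrow> qstate" where
  "uniform_state A \<kappa> = (\<lambda>a. if a \<in> A then \<kappa> else 0)"

lemma apply_local_uniform_state:
  assumes "finite A"
  shows "apply_local n U (uniform_state A \<kappa>) b =
    (if \<forall>v\<ge>n. b v = Leaf 0 then \<kappa> * (\<Sum>a\<in>A. \<Prod>v<n. U v (b v) (a v)) else 0)"
proof -
  have "(\<Sum>a\<in>{a. uniform_state A \<kappa> a \<noteq> 0}. uniform_state A \<kappa> a * (\<Prod>v<n. U v (b v) (a v)))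
      = (\<Sum>a\<in>A. uniform_state A \<kappa> a * (\<Prod>v<n. U v (b v) (a v)))"
    using assms by (intro sum.mono_neutral_left) (auto simp: uniform_state_def)
  also have "\<dots> = \<kappa> * (\<Sum>a\<in>A. \<Prod>v<n. U v (b v) (a v))"
    by (simp add: uniform_state_def sum_distrib_left)
  finally show ?thesis by (auto simp: apply_local_def)
qed

text \<open>An injective relabelling merges no two basis labels, so no amplitudes add up and the
  constant survives.\<close>

lemma push_uniform_state:
  assumes "inj_on g A"
  shows "push g (uniform_state A \<kappa>) = uniform_state (g ` A) \<kappa>"
proof
  fix c
  show "push g (uniform_state A \<kappa>) c = uniform_state (g ` A) \<kappa> c"
  proof (cases "c \<in> g ` A")
    case True
    then obtain a where a: "a \<in> A" "c = g a" by auto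
    have "{b. uniform_state A \<kappa> b \<noteq> 0 \<and> g b = c} = (if \<kappa> = 0 then {} else {a})"
      using a assms by (auto simp: uniform_state_def inj_on_def split: if_splits)
    then show ?thesis using a by (auto simp: push_def uniform_state_def)
  next
    case False
    then have "{b. uniform_state A \<kappa> b \<noteq> 0 \<and> g b = c} = {}"
      by (auto simp: uniform_state_def)
    then have "push g (uniform_state A \<kappa>) c = 0" unfolding push_def by (simp only: sum.empty)
    then show ?thesis using False by (simp add: uniform_state_def)
  qed
qed

text \<open>Column \<open>a\<close> is the uniform superposition of the labels \<open>e a r\<close>.
  These are distinct, giving norm 1, and the supports of different columns are disjoint.\<close>

lemma isometry_uniform:
  fixes e :: "lab \<Rightarrow> 'r::finite \<Rightarrow> lab"
  assumes inj: "\<And>a r a' r'. e a r = e a' r' \<Longrightarrow> a = a' \<and> r = r'"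
  shows "isometry (\<lambda>b a. if b \<in> range (e a) then of_real (1 / sqrt (real CARD('r))) else 0)"
proof -
  let ?c = "complex_of_real (1 / sqrt (real CARD('r)))"
  let ?U = "\<lambda>b a. if b \<in> range (e a) then ?c else 0"
  have c: "?c \<noteq> 0" by simp
  have supp: "{b. ?U b a \<noteq> 0} = range (e a)" for a
    using c by auto
  have "(\<Sum>b\<in>range (e a). cnj (?U b a) * ?U b a') = (if a = a' then 1 else 0)" for a a'
  proof (cases "a = a'")
    case True
    have "card (range (e a)) = CARD('r)"
      by (intro card_image injI) (use inj in blast)
    moreover have "cnj ?c * ?c = 1 / of_nat CARD('r)"
      by (simp flip: of_real_mult)
    ultimately show ?thesis using True by (simp del: of_real_divide)
  next
    case False
    then have "\<And>b. b \<in> range (e a) \<Longrightarrow> b \<notin> range (e a')"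
      using inj by blast
    then show ?thesis using False by simp
  qed
  then show ?thesis
    unfolding isometry_def supp by simp
qed

text \<open>A measurement prescribed on the image of \<open>I\<close> under \<open>e\<close> is
  completed to an isometry on all labels: any other label \<open>a\<close> goes to a
  \<open>Node\<close> recording \<open>a\<close>, orthogonal to every \<open>Leaf\<close> outcome
  and to the other records.\<close>

lemma isometry_extend:
  fixes e :: "'i \<Rightarrow> lab" and V :: "nat \<Rightarrow> 'i \<Rightarrow> complex"
  assumes inj: "inj_on e I"
    and orth: "\<And>i j. i \<in> I \<Longrightarrow> j \<in> I \<Longrightarrow> (\<Sum>k<N. cnj (V k i) * V k j) = (if i = j then 1 else 0)"
    and supp: "\<And>i k. k \<ge> N \<Longrightarrow> V k i = 0"
  shows "isometry (\<lambda>b a. if a \<in> e ` I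
      then (case b of Leaf k \<Rightarrow> V k (inv_into I e a) | Node _ _ \<Rightarrow> 0)
      else if b = Node a (\<lambda>_. Leaf 0) then 1 else 0)" (is "isometry ?W")
proof -
  have sub: "{b. ?W b a \<noteq> 0} \<subseteq> insert (Node a (\<lambda>_. Leaf 0)) (Leaf ` {..<N})" for a
  proof -
    have "b \<in> insert (Node a (\<lambda>_. Leaf 0)) (Leaf ` {..<N})" if "?W b a \<noteq> 0" for b
    proof (cases b)
      case (Leaf k)
      then have "V k (inv_into I e a) \<noteq> 0" using that by (simp split: if_splits)
      then have "k < N" using supp not_less by blast
      then show ?thesis using Leaf by simp
    next
      case (Node k m)
      then show ?thesis using that by (simp split: if_splits)
    qed
    then show ?thesis by blast
  qed
  have fin: "finite {b. ?W b a \<noteq> 0}" for a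
    by (rule finite_subset[OF sub]) simp
  have "(\<Sum>b\<in>{b. ?W b a \<noteq> 0}. cnj (?W b a) * ?W b a') = (if a = a' then 1 else 0)" for a a'
  proof -
    have "(\<Sum>b\<in>{b. ?W b a \<noteq> 0}. cnj (?W b a) * ?W b a')
        = (\<Sum>b\<in>insert (Node a (\<lambda>_. Leaf 0)) (Leaf ` {..<N}). cnj (?W b a) * ?W b a')"
      by (intro sum.mono_neutral_left sub) (auto split: if_splits)
    also have "\<dots> = cnj (?W (Node a (\<lambda>_. Leaf 0)) a) * ?W (Node a (\<lambda>_. Leaf 0)) a'
        + (\<Sum>k<N. cnj (?W (Leaf k) a) * ?W (Leaf k) a')"
      by (subst sum.insert) (auto simp: sum.reindex inj_on_def)
    also have "\<dots> = (if a = a' then 1 else 0)"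
    proof (cases "a \<in> e ` I \<and> a' \<in> e ` I")
      case True
      then obtain i j where "i \<in> I" "j \<in> I" "a = e i" "a' = e j" by auto
      then show ?thesis using inj by (auto simp: orth inj_on_eq_iff)
    next
      case False
      then show ?thesis by auto
    qed
    finally show ?thesis .
  qed
  then show ?thesis using fin by (simp add: isometry_def)
qed

section \<open>The local operations\<close>

definition bitlab :: "bool \<Rightarrow> lab" where
  "bitlab b = Leaf (of_bool b)"

lemma bitlab_inject [simp]: "bitlab b = bitlab c \<longleftrightarrow> b = c"
  by (auto simp: bitlab_def)

text \<open>Round 0 is idle. In round 1 node v creates a bit r in the state |+>, keeps one copy and sends a
  copy to its children. Attaching the new registers to an arbitrary old label a makes the operation an
  isometry on all labels, not only on the reachable ones.\<close>

definition idle_lab :: "lab \<Rightarrow> unit \<Rightarrow> lab" where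
  "idle_lab a _ = Node a (\<lambda>_. Leaf 0)"

definition send_lab :: "nat \<Rightarrow> nat \<Rightarrow> lab \<Rightarrow> bool \<Rightarrow> lab" where
  "send_lab n v a r =
     Node (Node a (\<lambda>_. bitlab r)) (\<lambda>u. if spider n v u \<and> v < u then bitlab r else Leaf 0)"

text \<open>The reachable label of node v after both rounds, where l is the bit of the parent and r its own.\<close>

definition recv_lab :: "nat \<Rightarrow> nat \<Rightarrow> bool \<times> bool \<Rightarrow> lab" where
  "recv_lab n v = (\<lambda>(l, r). Node (Node (Node (Leaf 0) (\<lambda>_. Leaf 0)) (\<lambda>_. bitlab r))
     (\<lambda>u. if spider n u v \<and> u < v then bitlab l else Leaf 0))"

text \<open>One exchange suffices to spread the entanglement; the idle round pads the run to the two
  rounds of the theorem.\<close>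

definition prep :: "nat \<Rightarrow> nat \<Rightarrow> nat \<Rightarrow> lab \<Rightarrow> lab \<Rightarrow> complex" where
  "prep n t v b a = (if t = 0 then if b \<in> range (idle_lab a) then 1 else 0
     else if b \<in> range (send_lab n v a) then of_real (1 / sqrt 2) else 0)"

text \<open>The outcome k < 4 encodes two bits, p = (k is odd) and q = (2 \<le> k). The pair (l, r) is measured in
  the Bell basis; at a tip (e = True) the bit p is a fair coin, and it selects whether l is measured in
  the X basis or in the Y basis.\<close>

definition bell_amp :: "bool \<Rightarrow> nat \<Rightarrow> bool \<times> bool \<Rightarrow> complex" where
  "bell_amp e k = (\<lambda>(l, r). if k < 4 \<and> odd k = (l \<noteq> r)
     then (if 2 \<le> k \<and> l then -1 else 1) * (if e \<and> odd k \<and> l then \<i> else 1) / of_real (sqrt 2)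
     else 0)"

text \<open>The centre has no parent and receives nothing; since 0 - 3 = 0 it is treated as its own parent.\<close>

definition bits :: "nat \<Rightarrow> (bool \<times> bool) set" where
  "bits v = {(l, r). v = 0 \<longrightarrow> l = r}"

definition final_meas :: "nat \<Rightarrow> nat \<Rightarrow> lab \<Rightarrow> lab \<Rightarrow> complex" where
  "final_meas n v b a = (if a \<in> recv_lab n v ` bits v
      then (case b of Leaf k \<Rightarrow> bell_amp (tip n v) k (inv_into (bits v) (recv_lab n v) a) | Node _ _ \<Rightarrow> 0)
      else if b = Node a (\<lambda>_. Leaf 0) then 1 else 0)"

text \<open>Column \<open>(l, r)\<close> has two entries of modulus 1 / sqrt 2, at the outcomes
  whose parity is l xor r. Columns of different parity have disjoint supports; \<open>(l, r)\<close>
  and its complement are orthogonal because the sign for q occurs in exactly one of them.\<close>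

lemma bell_amp_orthonormal: "(\<Sum>k<4. cnj (bell_amp e k i) * bell_amp e k j) = (if i = j then 1 else 0)"
proof -
  have s: "complex_of_real (sqrt 2) * complex_of_real (sqrt 2) = 2"
    by (simp flip: of_real_mult)
  have "{..<4} = {0, 1, 2, 3 :: nat}" by auto
  moreover obtain l r l' r' where "i = (l, r)" "j = (l', r')" by fastforce
  ultimately show ?thesis
    by (cases l; cases r; cases l'; cases r'; cases e) (simp_all add: bell_amp_def s)
qed

text \<open>\<open>r\<close> is stored locally and \<open>l\<close> arrives from the parent
  \<open>v - 3\<close>. The centre has no such message, but there \<open>bits\<close> ties
  \<open>l\<close> to \<open>r\<close>.\<close>

lemma recv_lab_inj: "v < n \<Longrightarrow> inj_on (recv_lab n v) (bits v)"
proof (rule inj_onI)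
  fix i j assume v: "v < n" and ij: "i \<in> bits v" "j \<in> bits v" and eq: "recv_lab n v i = recv_lab n v j"
  obtain l r l' r' where [simp]: "i = (l, r)" "j = (l', r')" by fastforce
  have r: "r = r'"
    and l: "(if spider n u v \<and> u < v then bitlab l else Leaf 0) = (if spider n u v \<and> u < v then bitlab l' else Leaf 0)" for u
    using eq by (simp_all only: \<open>i = (l, r)\<close> \<open>j = (l', r')\<close> recv_lab_def prod.case lab.inject fun_eq_iff bitlab_inject)
  show "i = j"
  proof (cases "v = 0")
    case True
    then show ?thesis using ij r by (auto simp: bits_def)
  next
    case False
    then have "spider n (v - 3) v \<and> v - 3 < v" using v by (auto simp: spider_def)
    then show ?thesis using l[of "v - 3"] r by simp
  qed
qed

lemma isometry_final_meas: "v < n \<Longrightarrow> isometry (final_meas n v)"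
proof -
  assume "v < n"
  note isometry_extend[OF recv_lab_inj[OF this], where V = "bell_amp (tip n v)" and N = 4, OF bell_amp_orthonormal]
  then show ?thesis unfolding final_meas_def by (simp add: bell_amp_def split_beta)
qed

lemma isometry_prep: "isometry (prep n t v)"
proof (cases "t = 0")
  case True
  have "isometry (\<lambda>b a. if b \<in> range (idle_lab a) then of_real (1 / sqrt (real CARD(unit))) else 0)"
    by (rule isometry_uniform) (simp add: idle_lab_def)
  moreover have "1 / sqrt (real CARD(unit)) = 1" by simp
  ultimately show ?thesis using True unfolding prep_def[abs_def] by (simp only: if_True of_real_1 simp_thms)
next
  case False
  have "isometry (\<lambda>b a. if b \<in> range (send_lab n v a) then of_real (1 / sqrt (real CARD(bool))) else 0)"
    by (rule isometry_uniform) (auto simp: send_lab_def dest: fun_cong)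
  moreover have "sqrt (real CARD(bool)) = sqrt 2" by simp
  ultimately show ?thesis using False unfolding prep_def[abs_def] by (simp only: if_False)
qed

lemma well_formed_prep: "well_formed (spider n) v (prep n t v)"
  by (auto simp: well_formed_def prep_def idle_lab_def send_lab_def split: if_splits)

lemma quantum_alg_spider: "quantum_alg n (spider n) 2 (prep n) (final_meas n)"
  by (simp add: quantum_alg_def isometry_final_meas isometry_prep well_formed_prep)

section \<open>The global state, round by round\<close>

definition global_label :: "nat \<Rightarrow> (nat \<Rightarrow> lab) \<Rightarrow> nat \<Rightarrow> lab" where
  "global_label n a = (\<lambda>v. if v < n then a v else Leaf 0)"

lemma qrun_spider_1: "qrun n (spider n) (prep n) 1 = uniform_state {global_label n (\<lambda>_. Node (Leaf 0) (\<lambda>_. Leaf 0))} 1"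
proof -
  let ?g = "global_label n (\<lambda>_. Node (Leaf 0) (\<lambda>_. Leaf 0))"
  have 0: "qrun n (spider n) (prep n) 0 = uniform_state {\<lambda>_. Leaf 0} 1"
    by (auto simp: uniform_state_def)
  have "apply_local n (prep n 0) (uniform_state {\<lambda>_. Leaf 0} 1) = uniform_state {?g} 1"
  proof
    fix b
    have "(\<Prod>v<n. prep n 0 v (b v) (Leaf 0)) = (if \<forall>v<n. b v = Node (Leaf 0) (\<lambda>_. Leaf 0) then 1 else 0)"
      by (auto simp: prep_def idle_lab_def intro!: prod.neutral)
    moreover have "b = ?g \<longleftrightarrow> (\<forall>v\<ge>n. b v = Leaf 0) \<and> (\<forall>v<n. b v = Node (Leaf 0) (\<lambda>_. Leaf 0))"
      (is "_ \<longleftrightarrow> ?r")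
    proof
      assume ?r
      then have "b v = ?g v" for v by (cases "v < n") (simp_all add: global_label_def)
      then show "b = ?g" by blast
    qed (simp add: global_label_def)
    moreover have "apply_local n (prep n 0) (uniform_state {\<lambda>_. Leaf 0} 1) b =
        (if \<forall>v\<ge>n. b v = Leaf 0 then \<Prod>v<n. prep n 0 v (b v) (Leaf 0) else 0)"
      by (auto simp add: apply_local_uniform_state)
    ultimately show "apply_local n (prep n 0) (uniform_state {\<lambda>_. Leaf 0} 1) b = uniform_state {?g} 1 b"
      by (simp only: uniform_state_def singleton_iff split: if_split) simp
  qed
  moreover have "exch n (spider n) ?g = ?g"
    by (auto simp: exch_def global_label_def fun_eq_iff)
  ultimately show ?thesis
    using push_uniform_state[of "exch n (spider n)" "{?g}" 1] 0 by (simp del: qrun.simps(1))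
qed

text \<open>\<open>S\<close> is the set of nodes whose bit is 1. At the centre the truncated
  \<open>v - 3\<close> yields the equal bits that \<open>bits\<close> prescribes.\<close>

definition config :: "nat \<Rightarrow> nat set \<Rightarrow> nat \<Rightarrow> lab" where
  "config n S = global_label n (\<lambda>v. recv_lab n v (v - 3 \<in> S, v \<in> S))"

lemma config_inj: "inj_on (config n) (Pow {..<n})"
proof (rule inj_onI)
  fix S S' assume S: "S \<in> Pow {..<n}" "S' \<in> Pow {..<n}" and eq: "config n S = config n S'"
  have "v \<in> S \<longleftrightarrow> v \<in> S'" if "v < n" for v
    using fun_cong[OF eq, of v] that
    by (auto simp: config_def global_label_def recv_lab_def dest: fun_cong split: if_splits)
  then show "S = S'" using S by auto
qed

lemma qrun_spider_2:
  "qrun n (spider n) (prep n) 2 = uniform_state (config n ` Pow {..<n}) (of_real (1 / sqrt 2) ^ n)"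
proof -
  let ?z = "Node (Leaf 0) (\<lambda>_. Leaf 0)"
  let ?s = "\<lambda>S. global_label n (\<lambda>v. send_lab n v ?z (v \<in> S))"
  let ?c = "of_real (1 / sqrt 2) ^ n :: complex"
  have "apply_local n (prep n 1) (uniform_state {global_label n (\<lambda>_. ?z)} 1) = uniform_state (?s ` Pow {..<n}) ?c"
  proof
    fix b
    have "b \<in> ?s ` Pow {..<n}" if "\<forall>v\<ge>n. b v = Leaf 0" "\<forall>v<n. b v \<in> range (send_lab n v ?z)"
    proof -
      from that(2) have "\<forall>v<n. \<exists>r. b v = send_lab n v ?z r" by auto
      then obtain r where "\<forall>v<n. b v = send_lab n v ?z (r v)" by metis
      then have "b = ?s {v. v < n \<and> r v}"
        using that(1) by (auto simp: global_label_def fun_eq_iff)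
      then show ?thesis by (rule image_eqI) auto
    qed
    then have "b \<in> ?s ` Pow {..<n} \<longleftrightarrow> (\<forall>v\<ge>n. b v = Leaf 0) \<and> (\<forall>v<n. b v \<in> range (send_lab n v ?z))"
      by (auto simp: global_label_def)
    moreover have "(\<Prod>v<n. prep n 1 v (b v) (global_label n (\<lambda>_. ?z) v)) =
        (if \<forall>v<n. b v \<in> range (send_lab n v ?z) then ?c else 0)"
      by (auto simp: prep_def global_label_def)
    ultimately show "apply_local n (prep n 1) (uniform_state {global_label n (\<lambda>_. ?z)} 1) b = uniform_state (?s ` Pow {..<n}) ?c b"
      by (subst apply_local_uniform_state) (auto simp: uniform_state_def)
  qed
  moreover have ex: "exch n (spider n) (?s S) = config n S" for S
    by (auto simp: exch_def config_def global_label_def send_lab_def recv_lab_def spider_def fun_eq_iff)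
  \<comment> \<open>Injectivity of \<open>exch\<close> on the sent labels is inherited from
    \<open>config\<close>: all bits can be read off after the exchange.\<close>
  have "push (exch n (spider n)) (uniform_state (?s ` Pow {..<n}) ?c) = uniform_state (exch n (spider n) ` ?s ` Pow {..<n}) ?c"
    by (intro push_uniform_state inj_onI) (use config_inj[of n] in \<open>auto simp: ex inj_on_eq_iff\<close>)
  moreover have "exch n (spider n) ` ?s ` Pow {..<n} = config n ` Pow {..<n}"
    by (simp add: image_image ex)
  ultimately show ?thesis
    using qrun_spider_1[of n] by (simp add: numeral_2_eq_2 del: of_real_divide)
qed

lemma final_state:
  "apply_local n (final_meas n) (qrun n (spider n) (prep n) 2) (global_label n (\<lambda>v. Leaf (k v)))
    = of_real (1 / sqrt 2) ^ n * (\<Sum>S\<in>Pow {..<n}. \<Prod>v<n. bell_amp (tip n v) (k v) (v - 3 \<in> S, v \<in> S))"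
proof -
  have "final_meas n v (global_label n (\<lambda>v. Leaf (k v)) v) (config n S v) = bell_amp (tip n v) (k v) (v - 3 \<in> S, v \<in> S)"
    if "v < n" for v S
  proof -
    have "(v - 3 \<in> S, v \<in> S) \<in> bits v" by (auto simp: bits_def)
    then show ?thesis using that recv_lab_inj[OF that]
      by (auto simp: final_meas_def global_label_def config_def)
  qed
  then show ?thesis
    unfolding qrun_spider_2
    by (subst apply_local_uniform_state) (simp_all add: sum.reindex[OF config_inj] global_label_def del: of_real_divide)
qed

text \<open>A nonzero amplitude needs some \<open>S\<close> with all local factors nonzero, and on
  reachable labels \<open>final_meas\<close> has only \<open>Leaf\<close> outcomes.\<close>

lemma final_state_support:
  assumes "apply_local n (final_meas n) (qrun n (spider n) (prep n) 2) a \<noteq> 0"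
  shows "\<exists>k. a = global_label n (\<lambda>v. Leaf (k v))"
proof -
  have eq: "apply_local n (final_meas n) (qrun n (spider n) (prep n) 2) a =
      (if \<forall>v\<ge>n. a v = Leaf 0 then of_real (1 / sqrt 2) ^ n *
        (\<Sum>c\<in>config n ` Pow {..<n}. \<Prod>v<n. final_meas n v (a v) (c v)) else 0)"
    unfolding qrun_spider_2 by (rule apply_local_uniform_state) simp
  have tail: "\<forall>v\<ge>n. a v = Leaf 0"
    using assms eq by metis
  have "(\<Sum>c\<in>config n ` Pow {..<n}. \<Prod>v<n. final_meas n v (a v) (c v)) \<noteq> 0"
    using assms eq by (metis mult_zero_right)
  then have "\<exists>c\<in>config n ` Pow {..<n}. (\<Prod>v<n. final_meas n v (a v) (c v)) \<noteq> 0"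
    by (rule contrapos_np) (simp add: sum.neutral)
  then obtain S where "(\<Prod>v<n. final_meas n v (a v) (config n S v)) \<noteq> 0"
    by blast
  then have nz: "final_meas n v (a v) (config n S v) \<noteq> 0" if "v < n" for v
    using that by auto
  have "\<exists>k. a v = Leaf k" if "v < n" for v
  proof -
    have "config n S v \<in> recv_lab n v ` bits v"
      using that by (auto simp: config_def global_label_def bits_def)
    then show ?thesis using nz[OF that] by (cases "a v") (auto simp: final_meas_def)
  qed
  then obtain k where "\<forall>v<n. a v = Leaf (k v)" by metis
  then have "a = global_label n (\<lambda>v. Leaf (k v))"
    using tail by (auto simp: global_label_def fun_eq_iff)
  then show ?thesis by blast
qed

definition out_of :: "nat \<Rightarrow> lab \<Rightarrow> nat" where
  "out_of v a = (case a of Leaf k \<Rightarrow> k | Node _ _ \<Rightarrow> 0)"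

text \<open>The output list determines the measured labels, so at most one term of the sum in
  \<open>quantum_prob\<close> survives.\<close>

lemma quantum_prob_spider:
  "quantum_prob n (spider n) 2 (prep n) (final_meas n) out_of x =
    (if length x = n then (cmod (of_real (1 / sqrt 2) ^ n *
       (\<Sum>S\<in>Pow {..<n}. \<Prod>v<n. bell_amp (tip n v) (x ! v) (v - 3 \<in> S, v \<in> S))))\<^sup>2 else 0)"
proof -
  let ?\<psi> = "apply_local n (final_meas n) (qrun n (spider n) (prep n) 2)"
  let ?A = "{a. ?\<psi> a \<noteq> 0 \<and> map (\<lambda>v. out_of v (a v)) [0..<n] = x}"
  let ?a = "global_label n (\<lambda>v. Leaf (x ! v))"
  have A: "length x = n \<and> a = ?a" if "a \<in> ?A" for a
  proof -
    from that final_state_support obtain k where k: "a = global_label n (\<lambda>v. Leaf (k v))" by blast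
    with that have "x = map k [0..<n]" by (auto simp: out_of_def global_label_def)
    then show ?thesis by (auto simp: k global_label_def fun_eq_iff)
  qed
  have "map (\<lambda>v. out_of v (?a v)) [0..<n] = x" if "length x = n"
    using that by (auto simp: out_of_def global_label_def intro!: nth_equalityI)
  then have in_A: "?a \<in> ?A" if "length x = n" "?\<psi> ?a \<noteq> 0"
    using that by blast
  have "(\<Sum>a\<in>?A. (cmod (?\<psi> a))\<^sup>2) = (if length x = n then (cmod (?\<psi> ?a))\<^sup>2 else 0)"
  proof (cases "length x = n \<and> ?\<psi> ?a \<noteq> 0")
    case True
    then have "?A = {?a}"
      by (intro equalityI subsetI singletonI) (use A in_A in blast)+
    then have "(\<Sum>a\<in>?A. (cmod (?\<psi> a))\<^sup>2) = (\<Sum>a\<in>{?a}. (cmod (?\<psi> a))\<^sup>2)"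
      by (rule arg_cong)
    then show ?thesis using True by simp
  next
    case False
    have "?A = {}"
    proof (rule equals0I)
      fix a assume a: "a \<in> ?A"
      then have "?\<psi> a \<noteq> 0" by (elim CollectE conjE)
      with False A[OF a] show False by metis
    qed
    then have "(\<Sum>a\<in>?A. (cmod (?\<psi> a))\<^sup>2) = (\<Sum>a\<in>{}. (cmod (?\<psi> a))\<^sup>2)"
      by (rule arg_cong)
    then show ?thesis using False by auto
  qed
  then have "quantum_prob n (spider n) 2 (prep n) (final_meas n) out_of x = (if length x = n then (cmod (?\<psi> ?a))\<^sup>2 else 0)"
    unfolding quantum_prob_def Let_def .
  then show ?thesis unfolding final_state .
qed

section \<open>The output distribution\<close>

text \<open>The outcomes p determine all bits up to a global flip: node v carries the bit of the centre
  xor walk k v. Hence exactly two terms of the amplitude survive; phase n k v is the contribution of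
  node v to their quotient total_phase n k, and the probability of k is proportional to 1 + Re (total_phase n k).\<close>

fun walk :: "(nat \<Rightarrow> nat) \<Rightarrow> nat \<Rightarrow> bool" where
  "walk k v = (if v = 0 then False else (walk k (v - 3) \<noteq> odd (k v)))"

declare walk.simps [simp del]

lemma walk_0 [simp]: "walk k 0 = False"
  by (simp add: walk.simps)

lemma walk_pos: "v > 0 \<Longrightarrow> walk k v = (walk k (v - 3) \<noteq> odd (k v))"
  by (subst walk.simps) simp

definition phase :: "nat \<Rightarrow> (nat \<Rightarrow> nat) \<Rightarrow> nat \<Rightarrow> complex" where
  "phase n k v = (if 2 \<le> k v then -1 else 1) *
     (if tip n v \<and> odd (k v) then (if walk k (v - 3) then -\<i> else \<i>) else 1)"

definition total_phase :: "nat \<Rightarrow> (nat \<Rightarrow> nat) \<Rightarrow> complex" where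
  "total_phase n k = (\<Prod>v<n. phase n k v)"

lemma norm_total_phase: "cmod (total_phase n k) = 1"
proof -
  have "cmod (phase n k v) = 1" for v by (simp add: phase_def norm_mult)
  then show ?thesis unfolding total_phase_def by (subst prod_norm[symmetric]) simp
qed

text \<open>The two bit assignments compatible with the measured parities; \<open>s\<close> is the
  bit of the centre.\<close>

definition branch :: "nat \<Rightarrow> (nat \<Rightarrow> nat) \<Rightarrow> bool \<Rightarrow> nat set" where
  "branch n k s = {v. v < n \<and> walk k v \<noteq> s}"

text \<open>A nonzero factor at \<open>v\<close> forces \<open>odd (k v)\<close> to be the xor of
  the bits of \<open>v\<close> and its parent, so the bits propagate outwards from the
  centre.\<close>

lemma bell_amp_consistent:
  assumes "S \<subseteq> {..<n}" and "\<forall>v<n. bell_amp (tip n v) (k v) (v - 3 \<in> S, v \<in> S) \<noteq> 0"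
  shows "S = branch n k (0 \<in> S)"
proof -
  have "v \<in> S \<longleftrightarrow> (walk k v \<noteq> (0 \<in> S))" if "v < n" for v
    using that
  proof (induction v rule: less_induct)
    case (less v)
    show ?case
    proof (cases "v = 0")
      case False
      then have "v - 3 \<in> S \<longleftrightarrow> (walk k (v - 3) \<noteq> (0 \<in> S))"
        using less.IH[of "v - 3"] less.prems by simp
      moreover have "odd (k v) = ((v - 3 \<in> S) \<noteq> (v \<in> S))"
        using assms(2) less.prems by (auto simp: bell_amp_def split: if_splits)
      ultimately show ?thesis using False walk_pos[of v k] by auto
    qed simp
  qed
  then show ?thesis using assms(1) by (auto simp: branch_def)
qed

lemma bell_amp_branch:
  assumes "v < n" "k v < 4" "even (k 0)"
  shows "bell_amp (tip n v) (k v) (v - 3 \<in> branch n k s, v \<in> branch n k s) =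
    (if 2 \<le> k v \<and> (walk k (v - 3) \<noteq> s) then -1 else 1) *
    (if tip n v \<and> odd (k v) \<and> (walk k (v - 3) \<noteq> s) then \<i> else 1) / of_real (sqrt 2)"
proof -
  have "odd (k v) = ((walk k (v - 3) \<noteq> s) \<noteq> (walk k v \<noteq> s))"
    using assms(3) walk_pos[of v k] by (cases "v = 0") auto
  then show ?thesis using assms by (auto simp: bell_amp_def branch_def)
qed

text \<open>The two branches have amplitudes in the ratio z = \<open>total_phase n k\<close> of
  modulus 1, and |1 + z|^2 = 2 + 2 Re z. Preparation and Bell amplitudes contribute 2^-n each to the
  squared modulus.\<close>

lemma norm_final_amplitude:
  assumes n: "n > 0" and k: "\<forall>v<n. k v < 4" and k0: "even (k 0)"
  shows "(cmod (of_real (1 / sqrt 2) ^ n *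
       (\<Sum>S\<in>Pow {..<n}. \<Prod>v<n. bell_amp (tip n v) (k v) (v - 3 \<in> S, v \<in> S))))\<^sup>2
     = (2 + 2 * Re (total_phase n k)) / 4 ^ n"
proof -
  let ?P = "\<lambda>S. \<Prod>v<n. bell_amp (tip n v) (k v) (v - 3 \<in> S, v \<in> S)"
  let ?F = "?P (branch n k False)"
  have sub: "{branch n k False, branch n k True} \<subseteq> Pow {..<n}"
    by (auto simp: branch_def)
  have zero: "?P S = 0" if "S \<in> Pow {..<n} - {branch n k False, branch n k True}" for S
  proof (rule ccontr)
    assume "?P S \<noteq> 0"
    then have "S = branch n k (0 \<in> S)" using that by (intro bell_amp_consistent) auto
    then show False using that by (cases "0 \<in> S") auto
  qed
  have "0 \<in> branch n k True" "0 \<notin> branch n k False"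
    using n by (auto simp: branch_def)
  then have ne: "branch n k False \<noteq> branch n k True" by blast
  have "(\<Sum>S\<in>Pow {..<n}. ?P S) = (\<Sum>S\<in>{branch n k False, branch n k True}. ?P S)"
    using zero by (intro sum.mono_neutral_right sub) auto
  also have "\<dots> = ?F + ?P (branch n k True)" using ne by simp
  \<comment> \<open>Flipping all bits multiplies the factor at every \<open>v\<close> by its
    phase.\<close>
  also have "?P (branch n k True) = (\<Prod>v<n. phase n k v *
      bell_amp (tip n v) (k v) (v - 3 \<in> branch n k False, v \<in> branch n k False))"
    by (intro prod.cong refl) (use k k0 in \<open>auto simp: bell_amp_branch phase_def\<close>)
  also have "\<dots> = total_phase n k * ?F"
    by (simp add: prod.distrib total_phase_def)
  finally have "(\<Sum>S\<in>Pow {..<n}. ?P S) = (1 + total_phase n k) * ?F"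
    by (simp add: algebra_simps)
  moreover have "cmod ?F = (1 / sqrt 2) ^ n"
  proof -
    have "cmod ?F = (\<Prod>v<n. cmod (bell_amp (tip n v) (k v) (v - 3 \<in> branch n k False, v \<in> branch n k False)))"
      by (simp add: prod_norm)
    also have "\<dots> = (\<Prod>v<n. 1 / sqrt 2)"
      by (intro prod.cong refl) (use k k0 in \<open>auto simp: bell_amp_branch norm_mult norm_divide\<close>)
    finally show ?thesis by simp
  qed
  ultimately have "(cmod (of_real (1 / sqrt 2) ^ n * (\<Sum>S\<in>Pow {..<n}. ?P S)))\<^sup>2
      = ((1 / sqrt 2) ^ n)\<^sup>2 * ((1 / sqrt 2) ^ n)\<^sup>2 * (cmod (1 + total_phase n k))\<^sup>2"
    by (simp add: norm_mult norm_power power_mult_distrib norm_divide)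
  also have "((1 / sqrt 2) ^ n)\<^sup>2 = (1 / 2 :: real) ^ n"
  proof -
    have "((1 / sqrt 2) ^ n)\<^sup>2 = ((1 / sqrt 2)\<^sup>2) ^ n"
      by (simp only: power_mult[symmetric] mult.commute)
    then show ?thesis by (simp add: power_divide)
  qed
  also have "(1 / 2 :: real) ^ n * (1 / 2) ^ n = 1 / 4 ^ n"
    by (simp add: power_divide flip: power_mult_distrib)
  also have "(cmod (1 + total_phase n k))\<^sup>2 = 2 + 2 * Re (total_phase n k)"
  proof -
    have "(Re (total_phase n k))\<^sup>2 + (Im (total_phase n k))\<^sup>2 = 1"
      using norm_total_phase[of n k] by (simp add: cmod_power2[symmetric])
    then show ?thesis unfolding cmod_power2 by (simp add: power2_eq_square algebra_simps)
  qed
  finally show ?thesis by simp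
qed

lemma final_amplitude_eq_0:
  assumes "(\<exists>v<n. k v \<ge> 4) \<or> n > 0 \<and> odd (k 0)"
  shows "(\<Sum>S\<in>Pow {..<n}. \<Prod>v<n. bell_amp (tip n v) (k v) (v - 3 \<in> S, v \<in> S)) = 0"
proof (rule sum.neutral, rule ballI)
  fix S
  have "\<exists>v<n. bell_amp (tip n v) (k v) (v - 3 \<in> S, v \<in> S) = 0"
    using assms
  proof
    assume "\<exists>v<n. k v \<ge> 4"
    then obtain v where "v < n" "k v \<ge> 4" by blast
    then show ?thesis by (intro exI[of _ v]) (simp add: bell_amp_def)
  next
    assume "n > 0 \<and> odd (k 0)"
    then show ?thesis by (intro exI[of _ 0]) (simp add: bell_amp_def)
  qed
  then show "(\<Prod>v<n. bell_amp (tip n v) (k v) (v - 3 \<in> S, v \<in> S)) = 0"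
    by (auto simp: prod_zero_iff)
qed

definition outcomes :: "nat \<Rightarrow> nat list set" where
  "outcomes n = {x. length x = n \<and> (\<forall>v<n. x ! v < 4) \<and> even (x ! 0)}"

definition ghz_density :: "nat \<Rightarrow> nat list \<Rightarrow> real" where
  "ghz_density n x = (if x \<in> outcomes n then (2 + 2 * Re (total_phase n ((!) x))) / 4 ^ n else 0)"

lemma quantum_prob_ghz:
  assumes "n > 0"
  shows "quantum_prob n (spider n) 2 (prep n) (final_meas n) out_of x = ghz_density n x"
proof (cases "x \<in> outcomes n")
  case True
  then show ?thesis using assms norm_final_amplitude[of n "(!) x"]
    unfolding quantum_prob_spider ghz_density_def outcomes_def by simp
next
  case False
  then have "length x = n \<longrightarrow> (\<exists>v<n. x ! v \<ge> 4) \<or> n > 0 \<and> odd (x ! 0)"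
    using assms by (auto simp: outcomes_def not_less)
  then show ?thesis using False final_amplitude_eq_0[of n "(!) x"]
    unfolding quantum_prob_spider ghz_density_def by simp
qed

lemma finite_outcomes: "finite (outcomes n)"
proof (rule finite_subset)
  show "outcomes n \<subseteq> {x. set x \<subseteq> {..<4} \<and> length x = n}"
    by (auto simp: outcomes_def in_set_conv_nth)
qed (simp add: finite_lists_length_eq)

lemma ghz_density_nonneg: "0 \<le> ghz_density n x"
proof -
  have "\<bar>Re (total_phase n ((!) x))\<bar> \<le> 1"
    using abs_Re_le_cmod[of "total_phase n ((!) x)"] by (simp add: norm_total_phase)
  then show ?thesis by (simp add: ghz_density_def)
qed

text \<open>Flipping the bit q of the centre changes the sign of total_phase, so the interference terms cancel in
  every sum over a set invariant under this flip.\<close>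

definition flip :: "nat list \<Rightarrow> nat list" where
  "flip x = x[0 := 2 - x ! 0]"

lemma even_less_4: "k < 4 \<Longrightarrow> even k \<Longrightarrow> k = 0 \<or> k = (2::nat)"
  by presburger

lemma total_phase_flip:
  assumes "x \<in> outcomes n" "n \<ge> 4"
  shows "total_phase n ((!) (flip x)) = - total_phase n ((!) x)"
proof -
  obtain m where m: "n = Suc m" using assms(2) by (cases n) auto
  have len: "length x = n" and x0: "x ! 0 = 0 \<or> x ! 0 = 2"
    using assms even_less_4[of "x ! 0"] by (auto simp: outcomes_def)
  have eq: "flip x ! v = x ! v" if "v \<noteq> 0" for v
    using that by (simp add: flip_def)
  \<comment> \<open>\<open>walk\<close> starts with False at the centre and never reads the outcome
    of node 0.\<close>
  have w: "walk ((!) (flip x)) v = walk ((!) x) v" for v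
    by (induction v rule: less_induct) (metis walk.simps eq diff_less zero_less_numeral not_gr_zero)
  have "phase n ((!) (flip x)) v = phase n ((!) x) v" if "v \<noteq> 0" for v
    using that by (simp add: phase_def w eq)
  moreover have "phase n ((!) (flip x)) 0 = - phase n ((!) x) 0"
    using x0 len assms(2) by (auto simp: phase_def flip_def tip_def)
  ultimately show ?thesis
    unfolding total_phase_def m prod.lessThan_Suc_shift by simp
qed

lemma flip_outcomes: "x \<in> outcomes n \<Longrightarrow> n > 0 \<Longrightarrow> flip x \<in> outcomes n \<and> flip (flip x) = x"
proof -
  assume x: "x \<in> outcomes n" "n > 0"
  then have "x ! 0 = 0 \<or> x ! 0 = 2" using even_less_4[of "x ! 0"] by (auto simp: outcomes_def)
  moreover have "x[0 := x ! 0] = x" by simp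
  ultimately show ?thesis using x
    by (auto simp: outcomes_def flip_def nth_list_update simp del: list_update_id)
qed

lemma sum_ghz_density:
  assumes n: "n \<ge> 4" and S: "S \<subseteq> outcomes n" "\<And>x. x \<in> S \<Longrightarrow> flip x \<in> S"
  shows "(\<Sum>x\<in>S. ghz_density n x) = 2 * card S / 4 ^ n"
proof -
  have "(\<Sum>x\<in>S. Re (total_phase n ((!) x))) = (\<Sum>x\<in>S. Re (total_phase n ((!) (flip x))))"
    by (rule sum.reindex_bij_witness[of _ flip flip]) (use S flip_outcomes[of _ n] n in auto)
  also have "\<dots> = - (\<Sum>x\<in>S. Re (total_phase n ((!) x)))"
    by (subst sum_negf[symmetric], rule sum.cong) (use S n total_phase_flip in auto)
  finally have "(\<Sum>x\<in>S. Re (total_phase n ((!) x))) = 0" by simp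
  moreover have "(\<Sum>x\<in>S. ghz_density n x) = (\<Sum>x\<in>S. (2 + 2 * Re (total_phase n ((!) x))) / 4 ^ n)"
    using S by (intro sum.cong) (auto simp: ghz_density_def)
  moreover have "(\<Sum>x\<in>S. (2 + 2 * Re (total_phase n ((!) x))) / 4 ^ n) =
      (2 * card S + 2 * (\<Sum>x\<in>S. Re (total_phase n ((!) x)))) / 4 ^ n"
    by (simp add: sum.distrib sum_divide_distrib[symmetric] sum_distrib_left[symmetric])
  ultimately show ?thesis by simp
qed

section \<open>Counting outcome lists\<close>

lemma card_lists_nth:
  assumes "\<And>v. v < n \<Longrightarrow> finite (A v)"
  shows "card {x. length x = n \<and> (\<forall>v<n. x ! v \<in> A v)} = (\<Prod>v<n. card (A v))"
proof -
  have "bij_betw (\<lambda>f. map f [0..<n]) (Pi\<^sub>E {..<n} A) {x. length x = n \<and> (\<forall>v<n. x ! v \<in> A v)}"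
  proof (rule bij_betw_byWitness[where f' = "\<lambda>x. restrict ((!) x) {..<n}"])
    show "\<forall>f\<in>Pi\<^sub>E {..<n} A. restrict ((!) (map f [0..<n])) {..<n} = f"
      by (auto simp: fun_eq_iff PiE_def extensional_def)
    show "\<forall>x\<in>{x. length x = n \<and> (\<forall>v<n. x ! v \<in> A v)}. map (restrict ((!) x) {..<n}) [0..<n] = x"
      by (auto intro!: nth_equalityI)
    show "(\<lambda>f. map f [0..<n]) ` Pi\<^sub>E {..<n} A \<subseteq> {x. length x = n \<and> (\<forall>v<n. x ! v \<in> A v)}"
      by (rule image_subsetI) (simp add: PiE_mem)
    show "(\<lambda>x. restrict ((!) x) {..<n}) ` {x. length x = n \<and> (\<forall>v<n. x ! v \<in> A v)} \<subseteq> Pi\<^sub>E {..<n} A"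
      by (rule image_subsetI) simp
  qed
  from bij_betw_same_card[OF this] show ?thesis
    by (simp only: card_PiE[OF finite_lessThan])
qed

text \<open>The event that all tips measure in X (\<open>c\<close> = False) or all in Y
  (\<open>c\<close> = True).\<close>

definition tips_odd :: "nat \<Rightarrow> bool \<Rightarrow> nat list set" where
  "tips_odd n c = {x. \<forall>v. tip n v \<longrightarrow> odd (x ! v) = c}"

lemma card_outcomes: "n > 0 \<Longrightarrow> 2 * card (outcomes n) = 4 ^ n"
proof -
  assume "n > 0"
  then obtain m where m: "n = Suc m" by (cases n) auto
  define A where "A = (\<lambda>v::nat. if v = 0 then {0, 2} else {..<4::nat})"
  have "outcomes n = {x. length x = n \<and> (\<forall>v<n. x ! v \<in> A v)}"
  proof (intro set_eqI iffI)
    fix x assume "x \<in> outcomes n"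
    then show "x \<in> {x. length x = n \<and> (\<forall>v<n. x ! v \<in> A v)}"
      using even_less_4[of "x ! 0"] by (auto simp: outcomes_def A_def m)
  next
    fix x assume "x \<in> {x. length x = n \<and> (\<forall>v<n. x ! v \<in> A v)}"
    then have len: "length x = n" and A: "\<And>v. v < n \<Longrightarrow> x ! v \<in> A v" by auto
    have "x ! v < 4" if "v < n" for v
      using A[OF that] by (cases "v = 0") (auto simp: A_def)
    then show "x \<in> outcomes n" using len A[of 0] by (auto simp: outcomes_def A_def m)
  qed
  then have "card (outcomes n) = (\<Prod>v<n. card (A v))"
    using card_lists_nth[of n A] by (simp add: A_def)
  also have "\<dots> = 2 * 4 ^ m"
    unfolding m prod.lessThan_Suc_shift by (simp add: A_def)
  finally show ?thesis using m by simp
qed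

lemma card_outcomes_tips: "n \<ge> 4 \<Longrightarrow> 16 * card (outcomes n \<inter> tips_odd n c) = 4 ^ n"
proof -
  assume "n \<ge> 4"
  \<comment> \<open>Now the tips are m + 1, m + 2 and m + 3. They and the centre have two admissible
    outcomes each, the other nodes four.\<close>
  then obtain m where m: "n = Suc (Suc (Suc (Suc m)))"
    by (auto dest!: le_Suc_ex)
  define B where "B = (if c then {1, 3} else {0, 2 :: nat})"
  define A where "A = (\<lambda>v::nat. if v = 0 then {0, 2} else if v \<le> m then {..<4::nat} else B)"
  have B: "k \<in> B \<longleftrightarrow> k < 4 \<and> odd k = c" for k
    unfolding B_def by (cases c; simp; presburger)
  have "outcomes n \<inter> tips_odd n c = {x. length x = n \<and> (\<forall>v<n. x ! v \<in> A v)}"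
  proof (intro set_eqI iffI)
    fix x assume x: "x \<in> outcomes n \<inter> tips_odd n c"
    have "x ! v \<in> A v" if "v < n" for v
      using x that even_less_4[of "x ! v"] by (auto simp: outcomes_def tips_odd_def tip_def A_def B m)
    then show "x \<in> {x. length x = n \<and> (\<forall>v<n. x ! v \<in> A v)}" using x by (simp add: outcomes_def)
  next
    fix x assume "x \<in> {x. length x = n \<and> (\<forall>v<n. x ! v \<in> A v)}"
    then have len: "length x = n" and A: "\<And>v. v < n \<Longrightarrow> x ! v \<in> A v" by auto
    have "x ! 0 \<in> {0, 2}" using A[of 0] by (simp add: A_def m)
    moreover have "x ! v < 4" if "v < n" for v
      using A[OF that] B[of "x ! v"] by (cases "v = 0"; cases "v \<le> m") (auto simp: A_def)
    moreover have "odd (x ! v) = c" if "tip n v" for v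
    proof -
      have "v < n" "v \<noteq> 0" "\<not> v \<le> m" using that by (auto simp: tip_def m)
      then show ?thesis using A[of v] B[of "x ! v"] by (simp add: A_def)
    qed
    ultimately show "x \<in> outcomes n \<inter> tips_odd n c"
      using len by (auto simp: outcomes_def tips_odd_def)
  qed
  then have "card (outcomes n \<inter> tips_odd n c) = (\<Prod>v<n. card (A v))"
    using card_lists_nth[of n A] by (simp add: A_def B_def)
  also have "\<dots> = (\<Prod>v<Suc m. card (A v)) * 8"
    unfolding m by (simp add: A_def B_def)
  also have "(\<Prod>v<Suc m. card (A v)) = 2 * 4 ^ m"
    unfolding prod.lessThan_Suc_shift by (simp add: A_def)
  finally show ?thesis using m by simp
qed

section \<open>The target distribution and its events\<close>

definition ghz_pmf :: "nat \<Rightarrow> nat list pmf" where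
  "ghz_pmf n = embed_pmf (ghz_density n)"

lemma pmf_ghz:
  assumes "n \<ge> 4"
  shows "pmf (ghz_pmf n) x = ghz_density n x"
  unfolding ghz_pmf_def
proof (rule pmf_embed_pmf[of "ghz_density n"])
  have "(\<integral>\<^sup>+x. ennreal (ghz_density n x) \<partial>count_space UNIV) = (\<Sum>x\<in>outcomes n. ennreal (ghz_density n x))"
    by (rule nn_integral_count_space'[OF finite_outcomes]) (auto simp: ghz_density_def)
  also have "\<dots> = ennreal (\<Sum>x\<in>outcomes n. ghz_density n x)"
    by (simp add: ghz_density_nonneg)
  also have "(\<Sum>x\<in>outcomes n. ghz_density n x) = 2 * card (outcomes n) / 4 ^ n"
    using assms flip_outcomes by (intro sum_ghz_density) auto
  also have "\<dots> = 1"
  proof -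
    have "real (2 * card (outcomes n)) = 4 ^ n" using card_outcomes[of n] assms by simp
    then show ?thesis by simp
  qed
  finally show "(\<integral>\<^sup>+x. ennreal (ghz_density n x) \<partial>count_space UNIV) = 1" by simp
qed (rule ghz_density_nonneg)

lemma set_pmf_ghz:
  assumes "n \<ge> 4"
  shows "set_pmf (ghz_pmf n) \<subseteq> outcomes n"
  using assms by (auto simp: set_pmf_eq pmf_ghz ghz_density_def)

lemma prob_ghz:
  assumes "n \<ge> 4"
  shows "measure_pmf.prob (ghz_pmf n) A = (\<Sum>x\<in>outcomes n \<inter> A. ghz_density n x)"
proof -
  have "measure_pmf.prob (ghz_pmf n) A = measure_pmf.prob (ghz_pmf n) (outcomes n \<inter> A)"
    using set_pmf_ghz[OF assms] by (intro measure_prob_cong_0) (auto simp: set_pmf_eq)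
  then show ?thesis
    using assms finite_outcomes[of n] by (simp add: measure_measure_pmf_finite pmf_ghz)
qed

text \<open>The value is that of three fair coins. The event ignores the centre and is thus stable
  under \<open>flip\<close>.\<close>

lemma prob_tips_odd:
  assumes "n \<ge> 4"
  shows "measure_pmf.prob (ghz_pmf n) (tips_odd n c) = 1 / 8"
proof -
  have "flip x \<in> tips_odd n c" if "x \<in> tips_odd n c" for x
    using that assms by (auto simp: tips_odd_def flip_def tip_def)
  then have "measure_pmf.prob (ghz_pmf n) (tips_odd n c) = 2 * card (outcomes n \<inter> tips_odd n c) / 4 ^ n"
    unfolding prob_ghz[OF assms] using assms flip_outcomes by (intro sum_ghz_density) auto
  moreover have "real (16 * card (outcomes n \<inter> tips_odd n c)) = 4 ^ n"
    using card_outcomes_tips[OF assms] by simp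
  ultimately show ?thesis by simp
qed

text \<open>The GHZ parity constraint: at phase -1 the two branches cancel. With an even number of Y
  tips the phase is 1 or -1, hence almost surely 1.\<close>

lemma prob_total_phase_minus_one:
  assumes "n \<ge> 4"
  shows "measure_pmf.prob (ghz_pmf n) {x. total_phase n ((!) x) = -1} = 0"
  unfolding prob_ghz[OF assms] by (intro sum.neutral) (auto simp: ghz_density_def)

section \<open>The GHZ contradiction along the arms\<close>

definition arm :: "nat \<Rightarrow> nat \<Rightarrow> nat set" where
  "arm n i = {v. 0 < v \<and> v < n \<and> v mod 3 = i}"

definition arm_phase :: "nat \<Rightarrow> (nat \<Rightarrow> nat) \<Rightarrow> nat \<Rightarrow> complex" where
  "arm_phase n k i = (\<Prod>v\<in>arm n i. phase n k v)"

text \<open>The parent \<open>v - 3\<close> has the same residue or is the centre, where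
  \<open>walk\<close> is False for all outcomes; so the corrections on an arm depend on this arm
  only.\<close>

lemma walk_cong:
  assumes "\<And>u. 0 < u \<Longrightarrow> u \<le> v \<Longrightarrow> u mod 3 = v mod 3 \<Longrightarrow> k u = k' u"
  shows "walk k v = walk k' v"
  using assms
proof (induction v rule: less_induct)
  case (less v)
  show ?case
  proof (cases "v = 0")
    case False
    have "walk k (v - 3) = walk k' (v - 3)"
    proof (cases "v \<le> 3")
      case v: False
      show ?thesis
      proof (rule less.IH)
        fix u assume "0 < u" "u \<le> v - 3" "u mod 3 = (v - 3) mod 3"
        moreover have "(v - 3) mod 3 = v mod 3" using v by (simp add: le_mod_geq)
        ultimately show "k u = k' u" using less.prems[of u] by simp
      qed (use v in simp)
    qed simp
    moreover have "k v = k' v" using less.prems[of v] False by simp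
    ultimately show ?thesis using False walk_pos[of v k] walk_pos[of v k'] by simp
  qed simp
qed

lemma phase_cong:
  assumes "k v = k' v" and "\<And>u. 0 < u \<Longrightarrow> u \<le> v \<Longrightarrow> u mod 3 = v mod 3 \<Longrightarrow> k u = k' u"
  shows "phase n k v = phase n k' v"
proof -
  have "walk k (v - 3) = walk k' (v - 3)"
  proof (cases "v \<le> 3")
    case v: False
    show ?thesis
    proof (rule walk_cong)
      fix u assume "0 < u" "u \<le> v - 3" "u mod 3 = (v - 3) mod 3"
      moreover have "(v - 3) mod 3 = v mod 3" using v by (simp add: le_mod_geq)
      ultimately show "k u = k' u" using assms(2)[of u] by simp
    qed
  qed simp
  then show ?thesis using assms(1) by (simp add: phase_def)
qed

lemma total_phase_cong:
  assumes "\<And>v. v < n \<Longrightarrow> k v = k' v"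
  shows "total_phase n k = total_phase n k'"
  unfolding total_phase_def by (intro prod.cong refl phase_cong) (use assms in auto)

lemma arm_phase_cong:
  assumes "\<And>v. v \<in> arm n i \<Longrightarrow> k v = k' v"
  shows "arm_phase n k i = arm_phase n k' i"
  unfolding arm_phase_def by (intro prod.cong refl phase_cong) (use assms in \<open>auto simp: arm_def\<close>)

lemma total_phase_split:
  assumes "n > 0"
  shows "total_phase n k = phase n k 0 * arm_phase n k 0 * arm_phase n k 1 * arm_phase n k 2"
proof -
  have "{..<n} = insert 0 (arm n 0 \<union> arm n 1 \<union> arm n 2)"
    using assms by (auto simp: arm_def)
  moreover have "finite (arm n i)" for i by (simp add: arm_def)
  moreover have "arm n 0 \<inter> arm n 1 = {}" "(arm n 0 \<union> arm n 1) \<inter> arm n 2 = {}"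
    "0 \<notin> arm n 0 \<union> arm n 1 \<union> arm n 2"
    by (auto simp: arm_def)
  ultimately show ?thesis
    by (simp add: total_phase_def arm_phase_def prod.union_disjoint mult.assoc)
qed

lemma phase_squared: "(phase n k v)\<^sup>2 = (if tip n v \<and> odd (k v) then -1 else 1)"
  by (simp add: phase_def power_mult_distrib)

text \<open>Each arm contains exactly one tip, the only node whose squared phase can be -1. An arm
  phase is thus real if the tip chose X and imaginary if it chose Y.\<close>

lemma arm_phase_squared:
  assumes n: "n = 3 * L + 1" "L > 0" and i: "i < 3" and k: "\<And>v. tip n v \<Longrightarrow> odd (k v) = c"
  shows "(arm_phase n k i)\<^sup>2 = (if c then -1 else 1)"
proof -
  obtain m where m: "n = 3 * m + 4" using n by (cases L) auto
  \<comment> \<open>The tip of arm \<open>i\<close>; arm 0 ends at a positive multiple of 3.\<close>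
  let ?e = "3 * m + (if i = 0 then 3 else i)"
  have i': "i = 0 \<or> i = 1 \<or> i = 2" using i by auto
  then have e: "?e \<in> arm n i"
    by (auto simp: arm_def m)
  have "tip n v \<longleftrightarrow> v = ?e" if "v \<in> arm n i" for v
  proof
    assume "tip n v"
    then have "v = 3 * m + 1 \<or> v = 3 * m + 2 \<or> v = 3 * m + 3" by (auto simp: tip_def m)
    then show "v = ?e" using that by (auto simp: arm_def mod_Suc; presburger)
  next
    assume "v = ?e"
    then show "tip n v" using i' by (auto simp: tip_def m)
  qed
  then have "(phase n k v)\<^sup>2 = (if v = ?e then if c then -1 else 1 else 1)" if "v \<in> arm n i" for v
    using that k by (auto simp: phase_squared)
  then have "(arm_phase n k i)\<^sup>2 = (\<Prod>v\<in>arm n i. if v = ?e then if c then -1 else 1 else 1)"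
    unfolding arm_phase_def prod_power_distrib by (rule prod.cong[OF refl])
  also have "\<dots> = (if c then -1 else 1)"
    using e by (subst prod.delta) (auto simp: arm_def)
  finally show ?thesis .
qed

text \<open>Models the output of a hybrid run in which the arms in \<open>s\<close> were
  resampled.\<close>

definition mixed :: "(nat \<Rightarrow> nat) \<Rightarrow> (nat \<Rightarrow> nat) \<Rightarrow> nat set \<Rightarrow> nat \<Rightarrow> nat" where
  "mixed a b s v = (if v > 0 \<and> v mod 3 \<in> s then b v else a v)"

definition even_patterns :: "nat set set" where
  "even_patterns = {{}, {1, 2}, {0, 2}, {0, 1}}"

lemma ghz_contradiction:
  assumes n: "n = 3 * L + 1" "L > 0"
    and a: "\<And>v. tip n v \<Longrightarrow> even (a v)" and b: "\<And>v. tip n v \<Longrightarrow> odd (b v)"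
  shows "\<exists>s\<in>even_patterns. total_phase n (mixed a b s) = -1"
proof (rule ccontr)
  assume no: "\<not> ?thesis"
  let ?A = "arm_phase n a" and ?B = "arm_phase n b" and ?z = "phase n a 0"
  have A2: "(?A i)\<^sup>2 = 1" if "i < 3" for i
    using arm_phase_squared[OF n that, of a False] a by simp
  have B2: "(?B i)\<^sup>2 = -1" if "i < 3" for i
    using arm_phase_squared[OF n that, of b True] b by simp
  have z2: "?z\<^sup>2 = 1"
    using n by (simp add: phase_squared tip_def)
  have arm_mixed: "arm_phase n (mixed a b s) i = (if i \<in> s then ?B i else ?A i)" for s i
    by (cases "i \<in> s") (auto intro!: arm_phase_cong simp: mixed_def arm_def)
  have phase_mixed: "phase n (mixed a b s) 0 = ?z" for s
    by (rule phase_cong) (auto simp: mixed_def)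
  have "n > 0" using n by simp
  then have total_phase_mixed: "total_phase n (mixed a b s) = ?z * (if 0 \<in> s then ?B 0 else ?A 0) *
      (if 1 \<in> s then ?B 1 else ?A 1) * (if 2 \<in> s then ?B 2 else ?A 2)" for s
    by (simp only: total_phase_split phase_mixed arm_mixed)
  \<comment> \<open>An even number of arms from \<open>b\<close> makes the square of the phase 1, so
    excluding -1 leaves 1.\<close>
  have one: "r = 1" if "r = total_phase n (mixed a b s)" "s \<in> even_patterns" "r\<^sup>2 = 1" for r s
    using that no by (auto simp: power2_eq_1_iff)
  have r1: "?z * ?A 0 * ?A 1 * ?A 2 = 1"
    by (rule one[of _ "{}"]) (simp_all add: total_phase_mixed even_patterns_def power_mult_distrib A2 B2 z2)
  have r2: "?z * ?A 0 * ?B 1 * ?B 2 = 1"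
    by (rule one[of _ "{1, 2}"]) (simp_all add: total_phase_mixed even_patterns_def power_mult_distrib A2 B2 z2)
  have r3: "?z * ?B 0 * ?A 1 * ?B 2 = 1"
    by (rule one[of _ "{0, 2}"]) (simp_all add: total_phase_mixed even_patterns_def power_mult_distrib A2 B2 z2)
  have r4: "?z * ?B 0 * ?B 1 * ?A 2 = 1"
    by (rule one[of _ "{0, 1}"]) (simp_all add: total_phase_mixed even_patterns_def power_mult_distrib A2 B2 z2)
  \<comment> \<open>Every arm occurs twice with a and twice with b, so the product of the four equations is - 1 = 1.\<close>
  have "(?z * ?A 0 * ?A 1 * ?A 2) * (?z * ?A 0 * ?B 1 * ?B 2) *
      ((?z * ?B 0 * ?A 1 * ?B 2) * (?z * ?B 0 * ?B 1 * ?A 2)) =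
      (?z\<^sup>2)\<^sup>2 * ((?A 0)\<^sup>2 * (?A 1)\<^sup>2 * (?A 2)\<^sup>2) * ((?B 0)\<^sup>2 * (?B 1)\<^sup>2 * (?B 2)\<^sup>2)"
    by algebra
  then show False
    unfolding r1 r2 r3 r4 by (simp add: A2 B2 z2)
qed

text \<open>Changing the residue class requires passing the centre, so a node of a foreign arm
  within distance \<open>T\<close> has index at most 3 T.\<close>

lemma near_spider:
  assumes "near (spider n) T v u" "v < n"
  shows "u < n \<and> u \<le> v + 3 * T \<and> v \<le> u + 3 * T \<and> (u mod 3 = v mod 3 \<or> u \<le> 3 * T)"
  using assms(1)
proof (induction T arbitrary: u)
  case 0
  then show ?case using assms(2) by simp
next
  case (Suc T)
  show ?case
  proof (cases "near (spider n) T v u")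
    case True
    then show ?thesis using Suc.IH[of u] by auto
  next
    case False
    with Suc.prems obtain w where w: "near (spider n) T v w" "spider n w u" by auto
    have "u mod 3 = w mod 3 \<or> u \<le> 3"
      using w(2) le_mod_geq[of 3 u] le_mod_geq[of 3 w] unfolding spider_def by (cases "3 \<le> w") auto
    moreover have "u < n" "u \<le> w + 3" "w \<le> u + 3" using w(2) by (auto simp: spider_def)
    ultimately show ?thesis using Suc.IH[OF w(1)] by auto
  qed
qed

section \<open>Two copies of the classical randomness\<close>

text \<open>The triangle inequality over \<open>A\<close> yields the whole l1 distance, which is
  twice \<open>tv_dist\<close>.\<close>

lemma tv_dist_prob:
  "\<bar>measure_pmf.prob p A - measure_pmf.prob q A\<bar> \<le> 2 * tv_dist (pmf p) (pmf q)"
proof -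
  have s: "Infinite_Set_Sum.abs_summable_on (\<lambda>x. pmf p x - pmf q x) B" for B
    by (intro abs_summable_on_diff pmf_abs_summable)
  then have s': "Infinite_Set_Sum.abs_summable_on (\<lambda>x. \<bar>pmf p x - pmf q x\<bar>) B" for B
    using abs_summable_on_norm_iff[of "\<lambda>x. pmf p x - pmf q x" B] by simp
  have "measure_pmf.prob p A - measure_pmf.prob q A = infsetsum (\<lambda>x. pmf p x - pmf q x) A"
    by (simp add: measure_pmf_conv_infsetsum infsetsum_diff pmf_abs_summable)
  then have "\<bar>measure_pmf.prob p A - measure_pmf.prob q A\<bar> \<le> infsetsum (\<lambda>x. \<bar>pmf p x - pmf q x\<bar>) A"
    using norm_infsetsum_bound[of "\<lambda>x. pmf p x - pmf q x" A] by simp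
  also have "\<dots> \<le> infsetsum (\<lambda>x. \<bar>pmf p x - pmf q x\<bar>) UNIV"
    by (rule infsetsum_mono_neutral_left[OF s' s']) auto
  also have "\<dots> = infsum (\<lambda>x. \<bar>pmf p x - pmf q x\<bar>) UNIV"
    by (rule infsetsum_infsum[OF s'])
  finally show ?thesis by (simp add: tv_dist_def)
qed

text \<open>On a countable type every law is discrete, so the classical output can be compared with
  the target as a pmf.\<close>

lemma pmf_of_random_variable:
  fixes X :: "'a \<Rightarrow> 'b :: countable"
  assumes "prob_space M" and X: "X \<in> measurable M (count_space UNIV)"
  obtains p where "\<And>A. measure_pmf.prob p A = measure M {\<omega> \<in> space M. X \<omega> \<in> A}"
proof -
  interpret M: prob_space M by fact
  let ?D = "distr M (count_space UNIV) X"
  interpret D: prob_space ?D by (rule M.prob_space_distr[OF X])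
  have "AE x in ?D. measure ?D {x} \<noteq> 0"
    by (subst D.AE_support_countable) (auto intro!: exI[of _ UNIV])
  then have p: "measure_pmf (Abs_pmf ?D) = ?D"
    by (intro Abs_pmf_inverse) (simp add: D.prob_space_axioms)
  have "measure_pmf.prob (Abs_pmf ?D) A = measure M {\<omega> \<in> space M. X \<omega> \<in> A}" for A
    unfolding p by (subst measure_distr[OF X]) (auto simp: vimage_def Int_def conj_commute)
  then show ?thesis by (rule that)
qed

text \<open>From two independent copies of the randomness, stored at the indices v and v + n, take the second
  one on R and the first one elsewhere.\<close>

definition pick :: "nat \<Rightarrow> nat set \<Rightarrow> (nat \<Rightarrow> 'a) \<Rightarrow> nat \<Rightarrow> 'a" where
  "pick n R \<omega> = (\<lambda>v\<in>{0..<n}. \<omega> (if v \<in> R then v + n else v))"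

text \<open>The selected indices are pairwise distinct, so the selected coordinates are again
  independent copies: resampling on any \<open>R\<close> leaves the law unchanged.\<close>

lemma distr_pick:
  assumes U: "prob_space U"
  shows "distr (PiM {0..<2 * n} (\<lambda>_. U)) (PiM {0..<n} (\<lambda>_. U)) (pick n R) = PiM {0..<n} (\<lambda>_. U)"
  unfolding pick_def
  by (rule distr_PiM_reindex[where f = "\<lambda>v. if v \<in> R then v + n else v" and M = "\<lambda>_. U"])
    (auto simp: U inj_on_def split: if_splits)

lemma measurable_pick:
  "pick n R \<in> measurable (PiM {0..<2 * n} (\<lambda>_. U)) (PiM {0..<n} (\<lambda>_. U))"
  unfolding pick_def by (intro measurable_restrict measurable_component_singleton) auto

text \<open>The two extreme selections read disjoint blocks of coordinates, and the doubled space is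
  the product of these blocks.\<close>

lemma pick_indep:
  assumes U: "prob_space U"
    and A: "A \<in> sets (PiM {0..<n} (\<lambda>_. U))" and B: "B \<in> sets (PiM {0..<n} (\<lambda>_. U))"
  shows "measure (PiM {0..<2 * n} (\<lambda>_. U))
      {\<omega> \<in> space (PiM {0..<2 * n} (\<lambda>_. U)). pick n {} \<omega> \<in> A \<and> pick n {0..<n} \<omega> \<in> B}
    = measure (PiM {0..<n} (\<lambda>_. U)) A * measure (PiM {0..<n} (\<lambda>_. U)) B"
proof -
  interpret U: prob_space U by fact
  interpret product_prob_space "\<lambda>_::nat. U" UNIV by unfold_locales
  let ?I = "{0..<n}" and ?J = "{n..<2 * n}"
  let ?M = "PiM ?I (\<lambda>_. U)" and ?N = "PiM ?J (\<lambda>_. U)" and ?K = "PiM {0..<2 * n} (\<lambda>_. U)"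
  let ?sh = "\<lambda>y. \<lambda>v\<in>?I. y (v + n)"
  let ?E = "{\<omega> \<in> space ?K. pick n {} \<omega> \<in> A \<and> pick n ?I \<omega> \<in> B}"
  have IJ: "?I \<union> ?J = {0..<2 * n}" by auto
  have K: "distr (?M \<Otimes>\<^sub>M ?N) ?K (merge ?I ?J) = ?K"
    using distr_merge[of ?I ?J] unfolding IJ by simp
  have sh: "distr ?N ?M ?sh = ?M"
    by (rule distr_PiM_reindex[where f = "\<lambda>v. v + n" and M = "\<lambda>_. U"]) (auto simp: U)
  have sh_meas: "?sh \<in> measurable ?N ?M"
    by (intro measurable_restrict measurable_component_singleton) auto
  have E: "?E \<in> sets ?K"
    using A B by (intro sets.sets_Collect_conj measurable_sets_Collect[OF measurable_pick]) auto
  have merge_meas: "merge ?I ?J \<in> measurable (?M \<Otimes>\<^sub>M ?N) ?K"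
    using measurable_merge[of ?I ?J "\<lambda>_. U"] unfolding IJ .
  interpret M: prob_space ?M by (intro prob_space_PiM U)
  interpret N: prob_space ?N by (intro prob_space_PiM U)
  have "measure ?K ?E = measure (distr (?M \<Otimes>\<^sub>M ?N) ?K (merge ?I ?J)) ?E"
    unfolding K ..
  also have "\<dots> = measure (?M \<Otimes>\<^sub>M ?N) (merge ?I ?J -` ?E \<inter> space (?M \<Otimes>\<^sub>M ?N))"
    by (rule measure_distr[OF merge_meas E])
  also have "merge ?I ?J -` ?E \<inter> space (?M \<Otimes>\<^sub>M ?N) = A \<times> (?sh -` B \<inter> space ?N)"
  proof -
    have mem: "merge ?I ?J z \<in> ?E \<longleftrightarrow> fst z \<in> A \<and> ?sh (snd z) \<in> B" if z: "z \<in> space (?M \<Otimes>\<^sub>M ?N)" for z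
    proof -
      obtain x y where [simp]: "z = (x, y)" by fastforce
      have x: "x \<in> extensional ?I" using z by (auto simp: space_pair_measure space_PiM PiE_def)
      have "merge ?I ?J z \<in> space ?K" using measurable_space[OF merge_meas z] .
      moreover have "pick n {} (merge ?I ?J (x, y)) = x"
        using x by (auto simp: pick_def merge_def fun_eq_iff extensional_def)
      moreover have "pick n ?I (merge ?I ?J (x, y)) = ?sh y"
        by (auto simp: pick_def merge_def fun_eq_iff)
      ultimately show ?thesis by simp
    qed
    have "A \<subseteq> space ?M" using A by (rule sets.sets_into_space)
    then show ?thesis
      using mem unfolding set_eq_iff vimage_eq Int_iff mem_Times_iff space_pair_measure by blast
  qed
  also have "measure (?M \<Otimes>\<^sub>M ?N) (A \<times> (?sh -` B \<inter> space ?N)) = measure ?M A * measure ?N (?sh -` B \<inter> space ?N)"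
    using A measurable_sets[OF sh_meas B]
    by (simp add: measure_def N.emeasure_pair_measure_Times enn2real_mult)
  also have "measure ?N (?sh -` B \<inter> space ?N) = measure (distr ?N ?M ?sh) B"
    by (rule measure_distr[OF sh_meas B, symmetric])
  finally show ?thesis unfolding sh .
qed

section \<open>The classical lower bound\<close>

text \<open>By independence the left-hand side is the probability of \<open>E\<close>. On
  \<open>E\<close> some hybrid run violates the parity constraint, and each of the four hybrids has
  the law of a genuine run, so a union bound applies.\<close>

lemma classical_bound:
  assumes n: "n = 3 * L + 1" and T: "2 * T + 1 \<le> L" and alg: "classical_alg n (spider n) T f"
    and p: "\<And>A. measure_pmf.prob p A =
      measure (rand_space n) {\<omega> \<in> space (rand_space n). map (\<lambda>v. f v \<omega>) [0..<n] \<in> A}"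
  shows "measure_pmf.prob p (tips_odd n False) * measure_pmf.prob p (tips_odd n True)
    \<le> 4 * measure_pmf.prob p {x. total_phase n ((!) x) = -1}"
proof -
  let ?U = "uniform_measure lborel {0..1::real}"
  let ?M = "rand_space n" and ?K = "PiM {0..<2 * n} (\<lambda>_. ?U)"
  define X where "X = (\<lambda>\<omega>. map (\<lambda>v. f v \<omega>) [0..<n])"
  \<comment> \<open>3 T is the cutoff of \<open>near_spider\<close>: up to this index a node may be
    visible from other arms.\<close>
  define R where "R = (\<lambda>s. {v. v mod 3 \<in> s \<and> 3 * T < v})"
  define V where "V = {x. total_phase n ((!) x) = -1}"
  define E where "E = {\<omega> \<in> space ?K. X (pick n {} \<omega>) \<in> tips_odd n False \<and> X (pick n {0..<n} \<omega>) \<in> tips_odd n True}"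
  define F where "F = (\<lambda>s. {\<omega> \<in> space ?K. X (pick n (R s) \<omega>) \<in> V})"
  have U: "prob_space ?U" by (rule prob_space_uniform_measure) simp_all
  have X: "X \<in> measurable ?M (count_space UNIV)"
    using alg by (simp add: classical_alg_def X_def)
  have loc: "f v \<omega> = f v \<omega>'" if "v < n" "\<And>u. near (spider n) T v u \<Longrightarrow> \<omega> u = \<omega>' u" for v \<omega> \<omega>'
    using alg that by (auto simp: classical_alg_def)
  have pick: "pick n S \<in> measurable ?K ?M" for S
    unfolding rand_space_def by (rule measurable_pick)
  have pX: "measure ?M {\<omega> \<in> space ?M. X \<omega> \<in> A} = measure_pmf.prob p A" for A
    by (simp add: p X_def)
  have sets_X: "{\<omega> \<in> space ?M. X \<omega> \<in> A} \<in> sets ?M" for A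
    using X by (rule measurable_sets_Collect) simp
  interpret K: prob_space ?K by (intro prob_space_PiM U)

  \<comment> \<open>Within distance T no node sees the resampled randomness of an arm other than its own, and the tips
    see nothing but resampled randomness.\<close>
  have nth_X: "X \<omega> ! v = f v \<omega>" if "v < n" for v \<omega>
    using that by (simp add: X_def)
  have cover: "E \<subseteq> (\<Union>s\<in>even_patterns. F s)"
  proof
    fix \<omega> assume \<omega>: "\<omega> \<in> E"
    define a b where "a = (\<lambda>v. f v (pick n {} \<omega>))" and "b = (\<lambda>v. f v (pick n (R UNIV) \<omega>))"
    have mix: "f v (pick n (R s) \<omega>) = mixed a b s v" if v: "v < n" for v s
    proof (cases "v > 0 \<and> v mod 3 \<in> s")
      case True
      have "f v (pick n (R s) \<omega>) = f v (pick n (R UNIV) \<omega>)"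
      proof (rule loc[OF v])
        fix u assume "near (spider n) T v u"
        then have "u \<in> R s \<longleftrightarrow> u \<in> R UNIV" using near_spider[of n T v u] v True by (auto simp: R_def)
        then show "pick n (R s) \<omega> u = pick n (R UNIV) \<omega> u" by (simp add: pick_def)
      qed
      then show ?thesis using True by (simp add: mixed_def b_def)
    next
      case False
      have "f v (pick n (R s) \<omega>) = f v (pick n {} \<omega>)"
      proof (rule loc[OF v])
        fix u assume "near (spider n) T v u"
        \<comment> \<open>Visible nodes beyond 3 T lie on the arm of \<open>v\<close>, which is not
          in \<open>s\<close>; from the centre there are none.\<close>
        then have "u \<notin> R s" using near_spider[of n T v u] v False by (auto simp: R_def)
        then show "pick n (R s) \<omega> u = pick n {} \<omega> u" by (simp add: pick_def)
      qed
      then show ?thesis using False by (auto simp: mixed_def a_def)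
    qed
    have "even (a v)" if "tip n v" for v
      using \<omega> that nth_X[of v "pick n {} \<omega>"] by (auto simp: E_def tips_odd_def a_def tip_def)
    moreover have "odd (b v)" if tip: "tip n v" for v
    proof -
      have v: "v < n" using tip by (simp add: tip_def)
      have "b v = f v (pick n {0..<n} \<omega>)"
        unfolding b_def
      proof (rule loc[OF v])
        fix u assume "near (spider n) T v u"
        \<comment> \<open>A tip has v \<ge> 3 L - 2, hence u \<ge> 3 L - 2 - 3 T, and L \<ge> 2 T +
          1 gives u \<ge> 3 T + 1.\<close>
        then have "u < n" "3 * T < u" using near_spider[of n T v u] v tip T by (auto simp: tip_def n)
        then show "pick n (R UNIV) \<omega> u = pick n {0..<n} \<omega> u" by (simp add: pick_def R_def)
      qed
      then show ?thesis
        using \<omega> tip v nth_X[of v "pick n {0..<n} \<omega>"] by (auto simp: E_def tips_odd_def)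
    qed
    ultimately obtain s where s: "s \<in> even_patterns" "total_phase n (mixed a b s) = -1"
      using ghz_contradiction[of n L a b] n T by auto
    have "total_phase n ((!) (X (pick n (R s) \<omega>))) = total_phase n (mixed a b s)"
      by (rule total_phase_cong) (simp add: nth_X mix)
    then show "\<omega> \<in> (\<Union>s\<in>even_patterns. F s)"
      using s \<omega> by (auto simp: F_def V_def E_def)
  qed

  have F_eq: "F s = pick n (R s) -` {\<omega> \<in> space ?M. X \<omega> \<in> V} \<inter> space ?K" for s
    using measurable_space[OF pick] by (auto simp: F_def)
  have F: "F s \<in> sets ?K" "measure ?K (F s) = measure_pmf.prob p V" for s
  proof -
    show "F s \<in> sets ?K" unfolding F_eq by (rule measurable_sets[OF pick sets_X])
    have "measure ?K (F s) = measure (distr ?K ?M (pick n (R s))) {\<omega> \<in> space ?M. X \<omega> \<in> V}"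
      unfolding F_eq by (rule measure_distr[OF pick sets_X, symmetric])
    also have "distr ?K ?M (pick n (R s)) = ?M"
      unfolding rand_space_def by (rule distr_pick[OF U])
    finally show "measure ?K (F s) = measure_pmf.prob p V" by (simp add: pX)
  qed
  have "E = {\<omega> \<in> space ?K. pick n {} \<omega> \<in> {\<omega> \<in> space ?M. X \<omega> \<in> tips_odd n False} \<and>
      pick n {0..<n} \<omega> \<in> {\<omega> \<in> space ?M. X \<omega> \<in> tips_odd n True}}"
    using measurable_space[OF pick] by (auto simp: E_def)
  then have "measure ?K E = measure ?M {\<omega> \<in> space ?M. X \<omega> \<in> tips_odd n False} *
      measure ?M {\<omega> \<in> space ?M. X \<omega> \<in> tips_odd n True}"
    using pick_indep[OF U sets_X[unfolded rand_space_def] sets_X[unfolded rand_space_def]]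
    unfolding rand_space_def by simp
  then have "measure_pmf.prob p (tips_odd n False) * measure_pmf.prob p (tips_odd n True) = measure ?K E"
    by (simp only: pX)
  also have "\<dots> \<le> measure ?K (\<Union>s\<in>even_patterns. F s)"
    using cover F by (intro K.finite_measure_mono sets.finite_UN) (auto simp: even_patterns_def)
  also have "\<dots> \<le> (\<Sum>s\<in>even_patterns. measure ?K (F s))"
    using F by (intro K.finite_measure_subadditive_finite) (auto simp: even_patterns_def)
  also have "\<dots> = card even_patterns * measure_pmf.prob p V"
    by (simp add: F)
  also have "\<dots> \<le> 4 * measure_pmf.prob p V"
  proof (rule mult_right_mono)
    have "card even_patterns \<le> 4"
      by (simp add: even_patterns_def card_insert_if)
    then show "real (card even_patterns) \<le> 4" by simp
  qed simp
  finally show ?thesis by (simp add: V_def)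
qed

lemma classical_lower_bound:
  assumes n: "n = 3 * L + 1" "L > 0" and alg: "classical_alg n (spider n) T f"
    and tv: "tv_dist (classical_prob n f) (pmf (ghz_pmf n)) \<le> 1 / 1000"
  shows "L \<le> 2 * T"
proof (rule ccontr)
  assume "\<not> L \<le> 2 * T"
  then have T: "2 * T + 1 \<le> L" by simp
  have n4: "n \<ge> 4" using n by simp
  have M: "prob_space (rand_space n)"
    unfolding rand_space_def by (intro prob_space_PiM prob_space_uniform_measure) simp_all
  have X: "(\<lambda>\<omega>. map (\<lambda>v. f v \<omega>) [0..<n]) \<in> measurable (rand_space n) (count_space UNIV)"
    using alg by (simp add: classical_alg_def)
  obtain p where p: "\<And>A. measure_pmf.prob p A =
      measure (rand_space n) {\<omega> \<in> space (rand_space n). map (\<lambda>v. f v \<omega>) [0..<n] \<in> A}"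
    using pmf_of_random_variable[OF M X] by blast
  have "classical_prob n f = pmf p"
    using p[of "{_}"] by (auto simp: classical_prob_def measure_pmf_single)
  then have tv: "\<bar>measure_pmf.prob p A - measure_pmf.prob (ghz_pmf n) A\<bar> \<le> 1 / 500" for A
    using tv_dist_prob[of p A "ghz_pmf n"] tv by simp
  let ?a = "measure_pmf.prob p (tips_odd n False)" and ?b = "measure_pmf.prob p (tips_odd n True)"
  \<comment> \<open>The constants fit since 1/8 - 1/500 exceeds 1/10 and 1/100 exceeds
    4/500.\<close>
  have "1 / 10 \<le> ?a" "1 / 10 \<le> ?b"
    using tv[of "tips_odd n False"] tv[of "tips_odd n True"] unfolding prob_tips_odd[OF n4] by linarith+
  then have "1 / 10 * (1 / 10) \<le> ?a * ?b" by (intro mult_mono) auto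
  also have "\<dots> \<le> 4 * measure_pmf.prob p {x. total_phase n ((!) x) = -1}"
    by (rule classical_bound[OF n(1) T alg p])
  also have "\<dots> \<le> 4 * (1 / 500)"
    using tv[of "{x. total_phase n ((!) x) = -1}"] by (simp add: prob_total_phase_minus_one[OF n4])
  finally show False by simp
qed

theorem theorem2:
  "\<exists>(N :: nat set) (G :: nat \<Rightarrow> nat \<Rightarrow> nat \<Rightarrow> bool) (D :: nat \<Rightarrow> nat list pmf).
     infinite N \<and>
     (\<forall>n\<in>N. graph_on n (G n) \<and> finite (set_pmf (D n)) \<and>
              (\<forall>x\<in>set_pmf (D n). length x = n)) \<and>
     (\<forall>n\<in>N. \<exists>U W out. quantum_alg n (G n) 2 U W \<and>
              (\<forall>x. quantum_prob n (G n) 2 U W out x = pmf (D n) x)) \<and>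
     (\<exists>c::real. c > 0 \<and> (\<exists>\<alpha>::real. \<alpha> > 0 \<and> (\<exists>n0. \<forall>n\<in>N. n \<ge> n0 \<longrightarrow>
        (\<forall>T f. classical_alg n (G n) T f \<and>
               tv_dist (classical_prob n f) (pmf (D n)) \<le> c
               \<longrightarrow> real T \<ge> \<alpha> * real n))))"
proof -
  define N where "N = range (\<lambda>L. 3 * Suc L + 1)"
  have N4: "n \<ge> 4" if "n \<in> N" for n
    using that by (auto simp: N_def)
  have "infinite N"
    unfolding N_def by (rule range_inj_infinite) (simp add: inj_def)
  moreover have "graph_on n (spider n) \<and> finite (set_pmf (ghz_pmf n)) \<and> (\<forall>x\<in>set_pmf (ghz_pmf n). length x = n)"
    if "n \<in> N" for n
    using set_pmf_ghz[OF N4[OF that]] finite_subset[OF _ finite_outcomes] graph_on_spider[of n]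
    by (auto simp: outcomes_def)
  moreover have "\<exists>U W out. quantum_alg n (spider n) 2 U W \<and>
      (\<forall>x. quantum_prob n (spider n) 2 U W out x = pmf (ghz_pmf n) x)" if "n \<in> N" for n
    using N4[OF that] quantum_alg_spider[of n] quantum_prob_ghz[of n] pmf_ghz[of n]
    by (intro exI[of _ "prep n"] exI[of _ "final_meas n"] exI[of _ out_of]) simp
  moreover have "real T \<ge> 1 / 12 * real n"
    if n: "n \<in> N" and alg: "classical_alg n (spider n) T f"
      and tv: "tv_dist (classical_prob n f) (pmf (ghz_pmf n)) \<le> 1 / 1000" for n T f
  proof -
    obtain L where L: "n = 3 * L + 1" "L > 0" using n unfolding N_def by blast
    \<comment> \<open>L \<le> 2 T gives n \<le> 6 T + 1, and L > 0 forces T \<ge> 1.\<close>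
    then have "n \<le> 12 * T" using classical_lower_bound[OF L alg tv] by simp
    then show ?thesis by simp
  qed
  ultimately show ?thesis
    by (intro exI[of _ N] exI[of _ spider] exI[of _ ghz_pmf] conjI ballI exI[of _ "1 / 1000 :: real"]
        exI[of _ "1 / 12 :: real"] exI[of _ 0] impI allI) auto
qed

end
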